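(* Let $k\ge 4$ be even and let $G$ be a simple graph without loops. Then the set of distinct $H$-eigenvalues of $\mathcal{A}(G^{k,k/2})$ equals the set of all eigenvalues of the adjacency matrices $A(G[U])$, where $U$ ranges over the nonempty subsets of $V(G)$ such that the induced subgraph $G[U]$ is connected. Likewise, the set of distinct $H$-eigenvalues of $\mathcal{Q}(G^{k,k/2})$ equals the set of all eigenvalues of the matrices $Q(G)[U]$ (the signless Laplacian matrices of the modified induced subgraphs $G^{\circ}[U]$), where $U$ ranges over the nonempty subsets of $V(G)$ such that $G[U]$ is connected.
   Context: For a simple graph $G$ and even $k\ge 4$, $G^{k,k/2}$ is the $k$-uniform hypergraph obtained by replacing each vertex $v$ of $G$ by a set $\mathbf{v}$ of $k/2$ new vertices (pairwise disjoint) and each edge $\{u,v\}$ of $G$ by the edge $\mathbf{u}\cup\mathbf{v}$. The degree of a vertex is the number of edges containing it. $\mathcal{A}(G^{k,k/2})$ is the order-$k$ tensor indexed by the vertices of $G^{k,k/2}$, with entry $1/(k-1)!$ at $(w_1,\dots,w_k)$ whenever $\{w_1,\dots,w_k\}$ is an edge and $0$ otherwise; $\mathcal{Q}=\mathcal{D}+\mathcal{A}$ with $\mathcal{D}$ the diagonal tensor of degrees. $\lambda$ is an $H$-eigenvalue of an order-$k$ tensor $\mathcal{T}$ if there is a nonzero real vector $x$ with $\sum_{i_2,\dots,i_k}t_{ii_2\dots i_k}x_{i_2}\cdots x_{i_k}=\lambda x_i^{k-1}$ for all $i$. $A(\cdot)$ denotes the adjacency matrix of a graph, $Q(G)=D(G)+A(G)$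 the signless Laplacian matrix ($D(G)$ diagonal matrix of degrees), $G[U]$ the subgraph induced by $U$, and $Q(G)[U]$ the principal submatrix of $Q(G)$ indexed by $U$. The modified induced subgraph $G^{\circ}[U]$ is $G[U]$ together with $d_v(G)-d_v(G[U])$ loops at each $v\in U$; its signless Laplacian matrix (loops contributing $1$ to degree, ignored by the adjacency matrix) is $Q(G)[U]$. A single vertex is regarded as a connected graph. *)

theory Defs
  imports Complex_Main "Graph_Theory.Graph_Theory"
begin

text \<open>
  A simple graph is a digraph satisfying the locale \<open>graph\<close>: finite, loop-free, without parallel
  arcs and symmetric. Each undirected edge is represented there by a pair of opposite arcs;
  \<open>edges\<close> recovers the set of undirected edges.
\<close>

definition edges :: "('a, 'b) pre_digraph \<Rightarrow> 'a set set" where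
  "edges G = {{u, v} | u v. u \<rightarrow>\<^bsub>G\<^esub> v}"

definition degree :: "'v set set \<Rightarrow> 'v \<Rightarrow> nat" where
  "degree E v = card {e \<in> E. v \<in> e}"

text \<open>
  A square matrix with rows and columns indexed by a finite set \<open>I\<close> is a binary function, of which
  only the values on \<open>I\<close> matter. Restricting the index set to \<open>U \<subseteq> I\<close> hence
  gives the principal submatrix indexed by \<open>U\<close>. Eigenvalues are complex; that they are real for
  symmetric matrices is not built in.
\<close>

definition eigenvalues :: "'a set \<Rightarrow> ('a \<Rightarrow> 'a \<Rightarrow> real) \<Rightarrow> complex set" where
  "eigenvalues I M = {\<mu>. \<exists>x :: 'a \<Rightarrow> complex. (\<exists>i\<in>I. x i \<noteq> 0) \<and>
     (\<forall>i\<in>I. (\<Sum>j\<in>I. complex_of_real (M i j) * x j) = \<mu> * x i)}"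

definition adjacency_matrix :: "('a, 'b) pre_digraph \<Rightarrow> 'a \<Rightarrow> 'a \<Rightarrow> real" where
  "adjacency_matrix G u v = (if u \<rightarrow>\<^bsub>G\<^esub> v then 1 else 0)"

definition degree_matrix :: "('a, 'b) pre_digraph \<Rightarrow> 'a \<Rightarrow> 'a \<Rightarrow> real" where
  "degree_matrix G u v = (if u = v then real (degree (edges G) u) else 0)"

definition signless_laplacian_matrix :: "('a, 'b) pre_digraph \<Rightarrow> 'a \<Rightarrow> 'a \<Rightarrow> real" where
  "signless_laplacian_matrix G u v = degree_matrix G u v + adjacency_matrix G u v"

text \<open>
  An order-\<open>k\<close> tensor indexed by a finite set \<open>V\<close> is a function on lists, of which only the values on
  lists of length \<open>k\<close> over \<open>V\<close> matter.
  In \<open>H_eigenvalues\<close> the eigenvector is real, whereas \<open>\<mu>\<close> is a priori complex.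
\<close>

definition H_eigenvalues :: "nat \<Rightarrow> 'v set \<Rightarrow> ('v list \<Rightarrow> real) \<Rightarrow> complex set" where
  "H_eigenvalues k V T = {\<mu>. \<exists>x :: 'v \<Rightarrow> real. (\<exists>i\<in>V. x i \<noteq> 0) \<and>
     (\<forall>i\<in>V. complex_of_real
         (\<Sum>js | set js \<subseteq> V \<and> length js = k - 1. T (i # js) * prod_list (map x js))
       = \<mu> * complex_of_real (x i ^ (k - 1)))}"

text \<open>
  The tensors of a \<open>k\<close>-uniform hypergraph with edge set \<open>E\<close>. A list of length \<open>k\<close> whose set of
  entries is an edge necessarily has distinct entries, the edge having \<open>k\<close> elements.
\<close>

definition adjacency_tensor :: "nat \<Rightarrow> 'v set set \<Rightarrow> 'v list \<Rightarrow> real" where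
  "adjacency_tensor k E ws = (if set ws \<in> E then 1 / fact (k - 1) else 0)"

definition degree_tensor :: "nat \<Rightarrow> 'v set set \<Rightarrow> 'v list \<Rightarrow> real" where
  "degree_tensor k E ws = (if ws = replicate k (hd ws) then real (degree E (hd ws)) else 0)"

definition signless_laplacian_tensor :: "nat \<Rightarrow> 'v set set \<Rightarrow> 'v list \<Rightarrow> real" where
  "signless_laplacian_tensor k E ws = degree_tensor k E ws + adjacency_tensor k E ws"


text \<open>
  In the hypergraph of order \<open>k\<close> built from \<open>G\<close>, the \<open>k/2\<close> new vertices replacing \<open>v\<close> are the
  pairs \<open>(v, i)\<close> with \<open>i < k/2\<close>.
\<close>

definition block :: "nat \<Rightarrow> 'a \<Rightarrow> ('a \<times> nat) set" where
  "block k v = {v} \<times> {..<k div 2}"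

definition power_verts :: "nat \<Rightarrow> ('a, 'b) pre_digraph \<Rightarrow> ('a \<times> nat) set" where
  "power_verts k G = (\<Union>v\<in>verts G. block k v)"

definition power_edges :: "nat \<Rightarrow> ('a, 'b) pre_digraph \<Rightarrow> ('a \<times> nat) set set" where
  "power_edges k G = (\<lambda>e. \<Union>v\<in>e. block k v) ` edges G"

end

theory Submission
  imports Defs "HOL-Combinatorics.Multiset_Permutations"
begin

text \<open>
  Let \<open>X v\<close> be the product of the entries of an \<open>H\<close>-eigenvector \<open>x\<close> over the block of \<open>v\<close> and
  \<open>S v\<close> the sum of \<open>X\<close> over the neighbours of \<open>v\<close>. With \<open>d v\<close> the diagonal entry of the tensor,
  the equation at \<open>(v, i)\<close>, multiplied by \<open>x (v, i)\<close>, reads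
  \<open>X v * S v = (l - d v) * x (v, i) ^ k\<close>. If \<open>l = d v\<close> for some \<open>v\<close>, then \<open>l\<close> is the eigenvalue of the
  single vertex \<open>v\<close>. Otherwise \<open>x (v, i) ^ k\<close> does not depend on \<open>i\<close>, and as \<open>k\<close> is even it equals
  \<open>(X v)\<^sup>2\<close>. Hence \<open>S v = (l - d v) * X v\<close> on the support of \<open>X\<close>, so \<open>X\<close> is an
  eigenvector on every component of its support. Conversely, an eigenvector on a vertex subset is
  lifted by taking \<open>k/2\<close>-th roots; where it vanishes the lifted equation holds since the blocks have
  at least two elements. The two tensors are the cases \<open>d = 0\<close> and \<open>d = degree\<close>.
\<close>

section \<open>Reduction to real eigenvalues and eigenvectors\<close>

text \<open>The Hermitian form of a real symmetric matrix takes real values, which forces \<mu> to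
  be real. The real and imaginary parts of an eigenvector then satisfy the same equation, and one of
  them is nonzero.\<close>

lemma eigenvalues_symmetric:
  assumes fin: "finite I" and sym: "\<And>i j. i \<in> I \<Longrightarrow> j \<in> I \<Longrightarrow> M i j = M j i"
  shows "eigenvalues I M = complex_of_real ` {l. \<exists>y. (\<exists>i\<in>I. y i \<noteq> 0) \<and>
           (\<forall>i\<in>I. (\<Sum>j\<in>I. M i j * y j) = l * y i)}"
proof (intro equalityI subsetI)
  fix \<mu> assume "\<mu> \<in> eigenvalues I M"
  then obtain x where nz: "\<exists>i\<in>I. x i \<noteq> 0"
    and eig: "\<And>i. i \<in> I \<Longrightarrow> (\<Sum>j\<in>I. complex_of_real (M i j) * x j) = \<mu> * x i"
    by (auto simp: eigenvalues_def)
  \<comment> \<open>\<open>N\<close> is the squared norm of \<open>x\<close> and \<open>F\<close>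
    the value at \<open>x\<close> of the Hermitian form of \<open>M\<close>; conjugating
    \<open>F = \<mu> * N\<close> will show that \<mu> is real.\<close>
  define N where "N = (\<Sum>i\<in>I. x i * cnj (x i))"
  define F where "F = (\<Sum>i\<in>I. \<Sum>j\<in>I. cnj (x i) * (complex_of_real (M i j) * x j))"
  have N_real: "N = complex_of_real (\<Sum>i\<in>I. (cmod (x i))\<^sup>2)"
    by (simp add: N_def complex_norm_square flip: of_real_power)
  have "(\<Sum>i\<in>I. (cmod (x i))\<^sup>2) \<noteq> 0"
    using nz fin by (subst sum_nonneg_eq_0_iff) auto
  hence N_nz: "N \<noteq> 0"
    unfolding N_real by (simp only: of_real_eq_0_iff not_False_eq_True)
  have "F = (\<Sum>i\<in>I. cnj (x i) * (\<mu> * x i))"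
    unfolding F_def by (intro sum.cong refl) (simp add: eig flip: sum_distrib_left)
  hence F_N: "F = \<mu> * N"
    by (simp add: N_def sum_distrib_left mult_ac)
  have "cnj F = (\<Sum>i\<in>I. \<Sum>j\<in>I. x i * (complex_of_real (M i j) * cnj (x j)))"
    by (simp add: F_def)
  also have "\<dots> = (\<Sum>i\<in>I. \<Sum>j\<in>I. cnj (x i) * (complex_of_real (M i j) * x j))"
    by (subst sum.swap) (auto intro!: sum.cong simp: sym mult_ac)
  finally have "cnj F = F"
    by (simp add: F_def)
  moreover have "cnj N = N"
    by (simp add: N_real)
  ultimately have "cnj \<mu> = \<mu>"
    using F_N N_nz by (metis complex_cnj_mult mult_right_cancel)
  hence \<mu>: "\<mu> = complex_of_real (Re \<mu>)"
    by (simp add: complex_eq_iff)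
  have re: "(\<Sum>j\<in>I. M i j * Re (x j)) = Re \<mu> * Re (x i)" if "i \<in> I" for i
    using arg_cong[OF eig[OF that], of Re] by (subst (asm) \<mu>) simp
  have im: "(\<Sum>j\<in>I. M i j * Im (x j)) = Re \<mu> * Im (x i)" if "i \<in> I" for i
    using arg_cong[OF eig[OF that], of Im] by (subst (asm) \<mu>) simp
  from nz have "(\<exists>i\<in>I. Re (x i) \<noteq> 0) \<or> (\<exists>i\<in>I. Im (x i) \<noteq> 0)"
    by (auto simp: complex_eq_iff)
  with re im have "\<exists>y. (\<exists>i\<in>I. y i \<noteq> 0) \<and> (\<forall>i\<in>I. (\<Sum>j\<in>I. M i j * y j) = Re \<mu> * y i)"
    by (elim disjE) (rule exI[of _ "\<lambda>i. Re (x i)"], blast, rule exI[of _ "\<lambda>i. Im (x i)"], blast)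
  with \<mu> show "\<mu> \<in> complex_of_real ` {l. \<exists>y. (\<exists>i\<in>I. y i \<noteq> 0) \<and>
           (\<forall>i\<in>I. (\<Sum>j\<in>I. M i j * y j) = l * y i)}"
    by blast
next
  fix \<mu> assume "\<mu> \<in> complex_of_real ` {l. \<exists>y. (\<exists>i\<in>I. y i \<noteq> 0) \<and>
           (\<forall>i\<in>I. (\<Sum>j\<in>I. M i j * y j) = l * y i)}"
  then obtain l y where \<mu>: "\<mu> = complex_of_real l" and nz: "\<exists>i\<in>I. y i \<noteq> 0"
    and eig: "\<And>i. i \<in> I \<Longrightarrow> (\<Sum>j\<in>I. M i j * y j) = l * y i"
    by blast
  have "(\<Sum>j\<in>I. complex_of_real (M i j) * complex_of_real (y j)) = \<mu> * complex_of_real (y i)"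
    if "i \<in> I" for i
    using eig[OF that] by (simp add: \<mu> flip: of_real_mult of_real_sum)
  with nz show "\<mu> \<in> eigenvalues I M"
    unfolding eigenvalues_def by (intro CollectI exI[of _ "\<lambda>i. complex_of_real (y i)"]) auto
qed

text \<open>The eigenvector is real already, so at an index where it is nonzero the equation
  exhibits \<mu> as a quotient of two reals.\<close>

lemma H_eigenvalues_real:
  "H_eigenvalues k V T = complex_of_real ` {l. \<exists>x. (\<exists>i\<in>V. x i \<noteq> 0) \<and>
     (\<forall>i\<in>V. (\<Sum>js | set js \<subseteq> V \<and> length js = k - 1. T (i # js) * prod_list (map x js))
        = l * x i ^ (k - 1))}"
    (is "_ = complex_of_real ` {l. \<exists>x. _ \<and> (\<forall>i\<in>V. ?S x i = _)}")
proof (intro equalityI subsetI)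
  fix \<mu> assume "\<mu> \<in> H_eigenvalues k V T"
  then obtain x where nz: "\<exists>i\<in>V. x i \<noteq> 0"
    and eig: "\<And>i. i \<in> V \<Longrightarrow> complex_of_real (?S x i) = \<mu> * complex_of_real (x i ^ (k - 1))"
    unfolding H_eigenvalues_def by blast
  from nz obtain i where i: "i \<in> V" "x i ^ (k - 1) \<noteq> 0"
    by auto
  hence "\<mu> = complex_of_real (?S x i / x i ^ (k - 1))"
    using eig[OF i(1)] by (simp add: field_simps)
  then obtain l where l: "\<mu> = complex_of_real l"
    by blast
  have "?S x i = l * x i ^ (k - 1)" if "i \<in> V" for i
    using eig[OF that] unfolding l by (simp only: of_real_eq_iff flip: of_real_mult)
  with nz l show "\<mu> \<in> complex_of_real ` {l. \<exists>x. (\<exists>i\<in>V. x i \<noteq> 0) \<and>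
     (\<forall>i\<in>V. ?S x i = l * x i ^ (k - 1))}"
    by blast
next
  fix \<mu> assume "\<mu> \<in> complex_of_real ` {l. \<exists>x. (\<exists>i\<in>V. x i \<noteq> 0) \<and>
     (\<forall>i\<in>V. ?S x i = l * x i ^ (k - 1))}"
  then obtain l x where \<mu>: "\<mu> = complex_of_real l" and nz: "\<exists>i\<in>V. x i \<noteq> 0"
    and eig: "\<And>i. i \<in> V \<Longrightarrow> ?S x i = l * x i ^ (k - 1)"
    by blast
  have "complex_of_real (?S x i) = \<mu> * complex_of_real (x i ^ (k - 1))" if "i \<in> V" for i
    unfolding eig[OF that] \<mu> by simp
  with nz show "\<mu> \<in> H_eigenvalues k V T"
    unfolding H_eigenvalues_def by blast
qed

section \<open>Tensor sums as sums over edges\<close>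

text \<open>An edge \<open>e\<close> through \<open>i\<close> arises from exactly the
  \<open>(k - 1)!\<close> orderings of \<open>e - {i}\<close>, all with the same product; their
  number cancels the entry \<open>1 / fact (k - 1)\<close>.\<close>

lemma sum_adjacency_tensor:
  fixes x :: "'v \<Rightarrow> real"
  assumes V: "finite V" and E: "\<And>e. e \<in> E \<Longrightarrow> e \<subseteq> V \<and> card e = k"
  shows "(\<Sum>js | set js \<subseteq> V \<and> length js = k - 1.
            adjacency_tensor k E (i # js) * prod_list (map x js))
       = (\<Sum>e | e \<in> E \<and> i \<in> e. prod x (e - {i}))"
proof -
  let ?L = "{js. set js \<subseteq> V \<and> length js = k - 1}"
  let ?E = "{e \<in> E. i \<in> e}"
  have fE: "finite ?E"
    using E V by (intro finite_subset[of ?E "Pow V"]) auto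
  have fL: "finite ?L"
    using V by (rule finite_lists_length_eq)
  have fib: "{js \<in> ?L. insert i (set js) = e} = permutations_of_set (e - {i})" if e: "e \<in> ?E" for e
  proof -
    have "finite e" and ce: "card e = k" and "e \<subseteq> V" and "i \<in> e"
      using e E V by (auto intro: finite_subset)
    hence c: "card (e - {i}) = k - 1"
      by simp
    show ?thesis
    proof (intro equalityI subsetI)
      fix js assume js: "js \<in> {js \<in> ?L. insert i (set js) = e}"
      hence "e - {i} \<subseteq> set js" and l: "length js = k - 1"
        by auto
      hence "set js = e - {i}"
        \<comment> \<open>\<open>set js\<close> has at most \<open>k - 1\<close> elements and
          contains \<open>e - {i}\<close>, which has exactly that many; so no entry repeats and none
          equals \<open>i\<close>.\<close>
        using c card_length[of js] card_seteq[of "set js" "e - {i}"] by auto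
      moreover from this have "distinct js"
        using c l by (simp add: card_distinct)
      ultimately show "js \<in> permutations_of_set (e - {i})"
        by blast
    next
      fix js assume js: "js \<in> permutations_of_set (e - {i})"
      show "js \<in> {js \<in> ?L. insert i (set js) = e}"
        using permutations_of_setD[OF js] length_finite_permutations_of_set[OF js] c
          \<open>e \<subseteq> V\<close> \<open>i \<in> e\<close> by auto
    qed
  qed
  have "(\<Sum>js\<in>?L. adjacency_tensor k E (i # js) * prod_list (map x js))
      = (\<Sum>js\<in>{js \<in> ?L. insert i (set js) \<in> ?E}. prod_list (map x js) / fact (k - 1))"
    using fL by (intro sum.mono_neutral_cong_right) (auto simp: adjacency_tensor_def)
  \<comment> \<open>The lists are sorted by the edge that they form together with
    \<open>i\<close>.\<close>
  also have "\<dots> = (\<Sum>e\<in>?E. \<Sum>js\<in>{js \<in> {js \<in> ?L. insert i (set js) \<in> ?E}. insert i (set js) = e}.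
                      prod_list (map x js) / fact (k - 1))"
    using fE by (intro sum.group[symmetric] finite_subset[OF _ fL]) auto
  also have "\<dots> = (\<Sum>e\<in>?E. \<Sum>js\<in>permutations_of_set (e - {i}). prod x (e - {i}) / fact (k - 1))"
  proof (intro sum.cong refl)
    fix e assume e: "e \<in> ?E"
    show "{js \<in> {js \<in> ?L. insert i (set js) \<in> ?E}. insert i (set js) = e}
            = permutations_of_set (e - {i})"
      using e by (subst fib[OF e, symmetric]) auto
  next
    fix e js assume "js \<in> permutations_of_set (e - {i})"
    note js = permutations_of_setD[OF this]
    show "prod_list (map x js) / fact (k - 1) = prod x (e - {i}) / fact (k - 1)"
      using prod.distinct_set_conv_list[OF js(2), of x] by (simp add: js(1))
  qed
  also have "\<dots> = (\<Sum>e\<in>?E. prod x (e - {i}))"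
  proof (intro sum.cong refl)
    fix e assume "e \<in> ?E"
    hence "finite (e - {i})" "card (e - {i}) = k - 1"
      using E V by (auto intro: finite_subset)
    thus "(\<Sum>js\<in>permutations_of_set (e - {i}). prod x (e - {i}) / fact (k - 1)) = prod x (e - {i})"
      by simp
  qed
  finally show ?thesis by simp
qed

lemma sum_diagonal_tensor:
  fixes x :: "'v \<Rightarrow> real"
  assumes V: "finite V" "i \<in> V" and k: "k > 0"
  shows "(\<Sum>js | set js \<subseteq> V \<and> length js = k - 1.
            (if i # js = replicate k i then c else 0) * prod_list (map x js)) = c * x i ^ (k - 1)"
proof -
  have r: "i # js = replicate k i \<longleftrightarrow> js = replicate (k - 1) i" for js
    using k by (cases k) auto
  have "(\<Sum>js | set js \<subseteq> V \<and> length js = k - 1.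
            (if i # js = replicate k i then c else 0) * prod_list (map x js))
     = (\<Sum>js\<in>{replicate (k - 1) i}. c * prod_list (map x js))"
    using V finite_lists_length_eq[OF V(1)] unfolding r
    by (intro sum.mono_neutral_cong_right) auto
  thus ?thesis by simp
qed


section \<open>Induced subgraphs and their components\<close>

lemma induce_subgraph_dominates_iff:
  "u \<rightarrow>\<^bsub>G \<restriction> U\<^esub> v \<longleftrightarrow> u \<rightarrow>\<^bsub>G\<^esub> v \<and> u \<in> U \<and> v \<in> U"
  by (auto simp: arcs_ends_conv)

lemma induce_subgraph_induce_subgraph: "C \<subseteq> U \<Longrightarrow> (G \<restriction> U) \<restriction> C = G \<restriction> C"
  by (auto simp: induce_subgraph_def)

text \<open>Meant for \<open>U\<close> the support of an eigenvector: since \<open>C\<close> is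
  closed under neighbours in \<open>U\<close>, no nonzero neighbour value is lost on passing from
  \<open>U\<close> to \<open>C\<close>.\<close>

lemma (in sym_digraph) component_in_subset:
  assumes U: "U \<subseteq> verts G" and v: "v \<in> U"
  obtains C where "v \<in> C" "C \<subseteq> U" "Digraph_Component.connected (G \<restriction> C)"
    "\<And>u w. u \<in> C \<Longrightarrow> w \<in> U \<Longrightarrow> u \<rightarrow>\<^bsub>G\<^esub> w \<Longrightarrow> w \<in> C"
proof -
  interpret H: sym_digraph "G \<restriction> U"
    using U by (intro induced_graph_imp_graph induced_induce)
  define C where "C = {w. v \<rightarrow>\<^sup>*\<^bsub>G \<restriction> U\<^esub> w}"
  have CU: "C \<subseteq> U"
    using H.reachable_in_verts(2) by (auto simp: C_def)
  have vC: "v \<in> C"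
    using v by (simp add: C_def reachable_def)
  have sub: "(G \<restriction> U) \<restriction> C = G \<restriction> C"
    by (rule induce_subgraph_induce_subgraph) fact
  interpret HC: sym_digraph "G \<restriction> C"
    using CU U by (intro induced_graph_imp_graph induced_induce) auto
  \<comment> \<open>Every vertex on a path from \<open>v\<close> inside \<open>U\<close> is itself
    reachable from \<open>v\<close>, so the path stays in \<open>C\<close>.\<close>
  have reach: "v \<rightarrow>\<^sup>*\<^bsub>G \<restriction> C\<^esub> w" if "w \<in> C" for w
    using H.induce_reachable_preserves_paths[of v w] that by (simp flip: C_def add: sub) (simp add: C_def)
  have "u \<rightarrow>\<^sup>*\<^bsub>G \<restriction> C\<^esub> w" if "u \<in> C" "w \<in> C" for u w
    using HC.symmetric_reachable'[OF reach[OF that(1)]] reach[OF that(2)] by (rule HC.reachable_trans)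
  \<comment> \<open>\<open>connected\<close> is defined through the symmetric closure, which for a
    symmetric digraph has the same reachability.\<close>
  hence "u \<rightarrow>\<^sup>*\<^bsub>mk_symmetric (G \<restriction> C)\<^esub> w" if "u \<in> C" "w \<in> C" for u w
    using that HC.sym_arcs by (simp add: HC.reachable_mk_symmetric_eq)
  hence "Digraph_Component.connected (G \<restriction> C)"
    using vC by (intro HC.connectedI strongly_connectedI) auto
  moreover have "w \<in> C" if "u \<in> C" "w \<in> U" "u \<rightarrow>\<^bsub>G\<^esub> w" for u w
    using that CU unfolding C_def
    by (auto intro!: H.reachable_adj_trans[of v u w] simp: induce_subgraph_dominates_iff)
  ultimately show ?thesis
    using that[OF vC CU] by blast
qed

lemma connected_singleton: "Digraph_Component.connected (G \<restriction> {v})"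
  unfolding Digraph_Component.connected_conv by simp

section \<open>Blocks and edges of the hypergraph\<close>

lemma mem_block_iff [simp]: "(u, i) \<in> block k v \<longleftrightarrow> u = v \<and> i < k div 2"
  by (auto simp: block_def)

lemma finite_block [simp]: "finite (block k v)"
  by (simp add: block_def)

lemma card_block [simp]: "card (block k v) = k div 2"
  by (simp add: block_def card_cartesian_product)

lemma prod_block: "prod x (block k v) = (\<Prod>i<k div 2. x (v, i))"
proof -
  have "block k v = Pair v ` {..<k div 2}"
    by (auto simp: block_def)
  thus ?thesis
    by (simp add: prod.reindex inj_on_def)
qed

lemma blocks_disjoint: "u \<noteq> v \<Longrightarrow> block k u \<inter> block k v = {}"
  by (auto simp: block_def)

context graph
begin

lemma dominates_sym: "u \<rightarrow>\<^bsub>G\<^esub> v \<Longrightarrow> v \<rightarrow>\<^bsub>G\<^esub> u"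
  by (rule graph_symmetric)

lemma dominates_neq: "u \<rightarrow>\<^bsub>G\<^esub> v \<Longrightarrow> u \<noteq> v"
  using adj_not_same by blast

lemma finite_neighbours [simp]: "finite {u. v \<rightarrow>\<^bsub>G\<^esub> u}"
  by (rule finite_subset[OF _ finite_verts]) (auto dest: adj_in_verts)

lemma degree_edges: "degree (edges G) v = card {u. v \<rightarrow>\<^bsub>G\<^esub> u}"
proof -
  have "{e \<in> edges G. v \<in> e} = (\<lambda>u. {v, u}) ` {u. v \<rightarrow>\<^bsub>G\<^esub> u}"
    by (auto simp: edges_def insert_commute intro: dominates_sym)
  moreover have "inj_on (\<lambda>u. {v, u}) {u. v \<rightarrow>\<^bsub>G\<^esub> u}"
    by (auto simp: inj_on_def doubleton_eq_iff)
  ultimately show ?thesis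
    by (simp add: degree_def card_image)
qed

lemma power_edgesE:
  assumes "e \<in> power_edges k G"
  obtains u v where "u \<rightarrow>\<^bsub>G\<^esub> v" "e = block k u \<union> block k v"
  using assms by (auto simp: power_edges_def edges_def)

lemma finite_power_verts: "finite (power_verts k G)"
  by (simp add: power_verts_def)

lemma power_edges_uniform:
  assumes e: "e \<in> power_edges k G" and k: "even k"
  shows "e \<subseteq> power_verts k G \<and> card e = k"
proof -
  obtain u v where uv: "u \<rightarrow>\<^bsub>G\<^esub> v" and e_eq: "e = block k u \<union> block k v"
    using e by (rule power_edgesE)
  have "card e = k div 2 + k div 2"
    unfolding e_eq using blocks_disjoint[OF dominates_neq[OF uv]] by (simp add: card_Un_disjoint)
  thus ?thesis
    using k adj_in_verts[OF uv] by (auto simp: e_eq power_verts_def)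
qed

lemma power_edges_containing:
  assumes i: "i < k div 2"
  shows "{e. e \<in> power_edges k G \<and> (v, i) \<in> e} = (\<lambda>u. block k v \<union> block k u) ` {u. v \<rightarrow>\<^bsub>G\<^esub> u}"
proof (intro equalityI subsetI)
  fix e assume "e \<in> {e. e \<in> power_edges k G \<and> (v, i) \<in> e}"
  hence "e \<in> power_edges k G" and vi: "(v, i) \<in> e"
    by auto
  from this(1) obtain u w where "u \<rightarrow>\<^bsub>G\<^esub> w" "e = block k u \<union> block k w"
    by (rule power_edgesE)
  with vi show "e \<in> (\<lambda>u. block k v \<union> block k u) ` {u. v \<rightarrow>\<^bsub>G\<^esub> u}"
    by (auto simp: Un_commute dest: dominates_sym)
next
  fix e assume "e \<in> (\<lambda>u. block k v \<union> block k u) ` {u. v \<rightarrow>\<^bsub>G\<^esub> u}"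
  then obtain u where "v \<rightarrow>\<^bsub>G\<^esub> u" "e = block k v \<union> block k u"
    by auto
  moreover from this have "{v, u} \<in> edges G"
    by (auto simp: edges_def)
  ultimately show "e \<in> {e. e \<in> power_edges k G \<and> (v, i) \<in> e}"
    using i by (auto simp: power_edges_def intro!: image_eqI[of _ _ "{v, u}"])
qed

lemma inj_on_power_edges_containing:
  assumes i: "i < k div 2"
  shows "inj_on (\<lambda>u. block k v \<union> block k u) {u. v \<rightarrow>\<^bsub>G\<^esub> u}"
proof (rule inj_onI)
  fix u w assume "u \<in> {u. v \<rightarrow>\<^bsub>G\<^esub> u}" "w \<in> {u. v \<rightarrow>\<^bsub>G\<^esub> u}"
    and eq: "block k v \<union> block k u = block k v \<union> block k w"
  hence "u \<noteq> v"
    using dominates_neq by auto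
  \<comment> \<open>As \<open>u \<noteq> v\<close>, the vertex \<open>(u, i)\<close> is not in the
    block of \<open>v\<close> and must come from the block of \<open>w\<close>.\<close>
  moreover have "(u, i) \<in> block k v \<union> block k w"
    using i by (simp flip: eq)
  ultimately show "u = w"
    by simp
qed

text \<open>Distinct neighbours give distinct edges, so each copy of \<open>v\<close> inherits its
  degree; this matches the diagonal of the tensor with that of the matrix.\<close>

lemma degree_power_edges:
  "i < k div 2 \<Longrightarrow> degree (power_edges k G) (v, i) = degree (edges G) v"
  unfolding degree_edges
  by (simp add: degree_def power_edges_containing card_image inj_on_power_edges_containing)

text \<open>Disjointness of the blocks splits the product over each edge; the rest of the block of
  \<open>v\<close> is a factor common to all edges through \<open>(v, i)\<close>.\<close>

lemma sum_power_edges_containing: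
  fixes x :: "'a \<times> nat \<Rightarrow> real"
  assumes i: "i < k div 2"
  shows "(\<Sum>e | e \<in> power_edges k G \<and> (v, i) \<in> e. prod x (e - {(v, i)}))
       = prod x (block k v - {(v, i)}) * (\<Sum>u | v \<rightarrow>\<^bsub>G\<^esub> u. prod x (block k u))"
proof -
  have "prod x (block k v \<union> block k u - {(v, i)})
      = prod x (block k v - {(v, i)}) * prod x (block k u)" if "v \<rightarrow>\<^bsub>G\<^esub> u" for u
  proof -
    have d: "block k v \<inter> block k u = {}"
      using dominates_neq[OF that] by (rule blocks_disjoint)
    hence "block k v \<union> block k u - {(v, i)} = (block k v - {(v, i)}) \<union> block k u"
      using i dominates_neq[OF that] by auto
    thus ?thesis
      using d by (simp only:) (rule prod.union_disjoint, auto)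
  qed
  thus ?thesis
    using i by (simp add: power_edges_containing sum.reindex inj_on_power_edges_containing
        sum_distrib_left)
qed

section \<open>Eigenvalue equations of tensor and matrix\<close>

text \<open>One formula serves both tensors: \<open>c\<close> is 0 for the adjacency tensor and the
  degree of \<open>v\<close> for the signless Laplacian tensor.\<close>

lemma sum_power_tensor:
  fixes x :: "'a \<times> nat \<Rightarrow> real"
  assumes k: "even k" "k > 0" and v: "v \<in> verts G" "i < k div 2"
  shows "(\<Sum>js | set js \<subseteq> power_verts k G \<and> length js = k - 1.
            ((if (v, i) # js = replicate k (v, i) then c else 0)
              + adjacency_tensor k (power_edges k G) ((v, i) # js)) * prod_list (map x js))
       = c * x (v, i) ^ (k - 1)
         + prod x (block k v - {(v, i)}) * (\<Sum>u | v \<rightarrow>\<^bsub>G\<^esub> u. prod x (block k u))"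
proof -
  have V: "(v, i) \<in> power_verts k G"
    using v by (auto simp: power_verts_def)
  show ?thesis
    unfolding distrib_right sum.distrib
    by (subst sum_diagonal_tensor[OF finite_power_verts V k(2)],
        subst sum_adjacency_tensor[OF finite_power_verts])
       (use power_edges_uniform k sum_power_edges_containing[OF v(2)] in auto)
qed

lemma sum_diagonal_plus_adjacency:
  fixes y :: "'a \<Rightarrow> real"
  assumes U: "U \<subseteq> verts G" and v: "v \<in> U"
  shows "(\<Sum>u\<in>U. ((if v = u then d v else 0) + adjacency_matrix G v u) * y u)
       = d v * y v + (\<Sum>u | u \<in> U \<and> v \<rightarrow>\<^bsub>G\<^esub> u. y u)"
proof -
  have fU: "finite U"
    using U finite_verts by (rule finite_subset)
  have "(\<Sum>u\<in>U. (if v = u then d v else 0) * y u) = d v * y v"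
    using fU v by (simp add: if_distrib[of "\<lambda>c. c * _"] cong: if_cong)
  moreover have "(\<Sum>u\<in>U. adjacency_matrix G v u * y u) = (\<Sum>u | u \<in> U \<and> v \<rightarrow>\<^bsub>G\<^esub> u. y u)"
    using fU by (intro sum.mono_neutral_cong_right) (auto simp: adjacency_matrix_def)
  ultimately show ?thesis
    by (simp add: distrib_right sum.distrib)
qed

section \<open>From H-eigenvectors to eigenvectors and back\<close>

text \<open>Multiplying the hypotheses over the block shows that the \<open>k div 2\<close>-th
  powers of the two sides agree. Both bases are nonnegative, \<open>q\<close> being an even power,
  so the bases agree too.\<close>

lemma block_values_square:
  fixes x :: "'a \<times> nat \<Rightarrow> real"
  assumes k: "even k" "k > 0" and q: "\<And>i. i < k div 2 \<Longrightarrow> x (v, i) ^ k = q"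
  shows "(prod x (block k v))\<^sup>2 = q"
proof -
  have h: "k div 2 > 0" and k2: "2 * (k div 2) = k"
    using k by auto
  have "((prod x (block k v))\<^sup>2) ^ (k div 2) = prod x (block k v) ^ k"
    by (simp add: k2 flip: power_mult)
  also have "\<dots> = (\<Prod>i<k div 2. x (v, i) ^ k)"
    by (simp add: prod_block prod_power_distrib)
  also have "\<dots> = q ^ (k div 2)"
    by (simp add: q)
  finally have "((prod x (block k v))\<^sup>2) ^ (k div 2) = q ^ (k div 2)" .
  moreover have "q \<ge> 0"
    using q[OF h] k(1) by (metis zero_le_even_power)
  ultimately show ?thesis
    using h by (simp add: power_eq_iff_eq_base)
qed

text \<open>The diagonal \<open>d\<close> is kept arbitrary to cover both tensors. The case split
  isolates \<open>l = d v\<close>, where division by \<open>l - d v\<close> is impossible.\<close>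

lemma connected_eigenvector_of_power:
  fixes x :: "'a \<times> nat \<Rightarrow> real"
  assumes k: "even k" "k > 0" and nz: "v0 \<in> verts G" "i0 < k div 2" "x (v0, i0) \<noteq> 0"
    and eig: "\<And>v i. v \<in> verts G \<Longrightarrow> i < k div 2 \<Longrightarrow>
      d v * x (v, i) ^ (k - 1)
        + prod x (block k v - {(v, i)}) * (\<Sum>u | v \<rightarrow>\<^bsub>G\<^esub> u. prod x (block k u))
      = l * x (v, i) ^ (k - 1)"
  obtains U y where "U \<subseteq> verts G" "U \<noteq> {}" "Digraph_Component.connected (G \<restriction> U)"
    "\<exists>u\<in>U. y u \<noteq> 0"
    "\<forall>v\<in>U. (\<Sum>u\<in>U. ((if v = u then d v else 0) + adjacency_matrix G v u) * y u) = l * y v"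
proof (cases "\<exists>v\<in>verts G. l = d v")
  case True
  then obtain v where v: "v \<in> verts G" "l = d v"
    by blast
  \<comment> \<open>Without a loop, the one-by-one matrix at \<open>v\<close> has the sole entry
    \<open>d v\<close>.\<close>
  have "\<not> v \<rightarrow>\<^bsub>G\<^esub> v"
    using dominates_neq by blast
  show ?thesis
    by (rule that[of "{v}" "\<lambda>_. 1"])
       (use v \<open>\<not> v \<rightarrow>\<^bsub>G\<^esub> v\<close> in \<open>auto simp: connected_singleton adjacency_matrix_def\<close>)
next
  case False
  define X where "X v = prod x (block k v)" for v
  define S where "S v = (\<Sum>u | v \<rightarrow>\<^bsub>G\<^esub> u. X u)" for v
  \<comment> \<open>The right-hand side is free of \<open>i\<close>, so all entries in a block have
    the same \<open>k\<close>-th power.\<close>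
  have pow: "x (v, i) ^ k = X v * S v / (l - d v)" if "v \<in> verts G" "i < k div 2" for v i
  proof -
    have "x (v, i) ^ k = x (v, i) * x (v, i) ^ (k - 1)"
      using k by (simp add: power_eq_if)
    moreover have "X v = x (v, i) * prod x (block k v - {(v, i)})"
      unfolding X_def using that by (intro prod.remove) auto
    moreover have "prod x (block k v - {(v, i)}) * S v = (l - d v) * x (v, i) ^ (k - 1)"
      using eig[OF that] by (simp add: S_def X_def algebra_simps)
    ultimately have "X v * S v = (l - d v) * x (v, i) ^ k"
      by simp
    thus ?thesis
      using False that by auto
  qed
  have sq: "(X v)\<^sup>2 = X v * S v / (l - d v)" if "v \<in> verts G" for v
    unfolding X_def by (rule block_values_square) (use k pow that in \<open>auto simp: X_def\<close>)
  have S: "S v = (l - d v) * X v" if "v \<in> verts G" "X v \<noteq> 0" for v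
  proof -
    have "l - d v \<noteq> 0"
      using that False by auto
    thus ?thesis
      using sq[OF that(1)] that(2) by (simp add: power2_eq_square eq_divide_eq mult_ac)
  qed
  define W where "W = {v \<in> verts G. X v \<noteq> 0}"
  \<comment> \<open>One nonzero entry forces the product over its whole block to be nonzero; so the
    support is nonempty, and \<open>v0\<close> selects a component of it.\<close>
  have "(X v0)\<^sup>2 = x (v0, i0) ^ k"
    using sq pow nz by simp
  hence "v0 \<in> W"
    using nz by (auto simp: W_def)
  moreover have W: "W \<subseteq> verts G"
    by (auto simp: W_def)
  ultimately obtain C where C: "v0 \<in> C" "C \<subseteq> W" "Digraph_Component.connected (G \<restriction> C)"
    "\<And>u w. u \<in> C \<Longrightarrow> w \<in> W \<Longrightarrow> u \<rightarrow>\<^bsub>G\<^esub> w \<Longrightarrow> w \<in> C"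
    using component_in_subset by metis
  show ?thesis
  proof (rule that[of C X])
    show CG: "C \<subseteq> verts G"
      using C W by auto
    show "C \<noteq> {}" and "\<exists>u\<in>C. X u \<noteq> 0"
      using C by (auto simp: W_def)
    show "\<forall>v\<in>C. (\<Sum>u\<in>C. ((if v = u then d v else 0) + adjacency_matrix G v u) * X u) = l * X v"
    proof
      fix v assume v: "v \<in> C"
      \<comment> \<open>A neighbour of \<open>v\<close> outside \<open>C\<close> lies outside
        \<open>W\<close> by closure, so \<open>X\<close> vanishes there and contributes nothing to
        \<open>S v\<close>.\<close>
      have "(\<Sum>u | u \<in> C \<and> v \<rightarrow>\<^bsub>G\<^esub> u. X u) = S v"
        unfolding S_def using C(4)[OF v]
        by (intro sum.mono_neutral_left) (auto simp: W_def dest: adj_in_verts)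
      thus "(\<Sum>u\<in>C. ((if v = u then d v else 0) + adjacency_matrix G v u) * X u) = l * X v"
        using S[of v] v C CG
        by (subst sum_diagonal_plus_adjacency) (auto simp: W_def algebra_simps)
    qed
  qed (fact C)
qed

text \<open>
  The value \<open>y v\<close> is spread evenly over the block of \<open>v\<close>, all of its sign going to the
  entry with index \<open>0\<close>.
\<close>

lemma power_eigenvector_of_subset:
  fixes y :: "'a \<Rightarrow> real"
  assumes k: "even k" "k \<ge> 4" and U: "U \<subseteq> verts G" and nz: "\<exists>u\<in>U. y u \<noteq> 0"
    and eig: "\<And>v. v \<in> U \<Longrightarrow>
      (\<Sum>u\<in>U. ((if v = u then d v else 0) + adjacency_matrix G v u) * y u) = l * y v"
  obtains x where "\<exists>w\<in>power_verts k G. x w \<noteq> 0"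
    "\<And>v i. i < k div 2 \<Longrightarrow>
      d v * x (v, i) ^ (k - 1)
        + prod x (block k v - {(v, i)}) * (\<Sum>u | v \<rightarrow>\<^bsub>G\<^esub> u. prod x (block k u))
      = l * x (v, i) ^ (k - 1)"
proof -
  define h where "h = k div 2"
  have h: "h \<ge> 2" and k2: "k = 2 * h"
    using k by (auto simp: h_def)
  \<comment> \<open>Extension by zero makes sums over all neighbours in \<open>G\<close> agree with
    sums over those in \<open>U\<close>.\<close>
  define Y where "Y v = (if v \<in> U then y v else 0)" for v
  define x :: "'a \<times> nat \<Rightarrow> real"
    where "x = (\<lambda>(v, i). (if i = 0 then sgn (Y v) else 1) * root h \<bar>Y v\<bar>)"
  \<comment> \<open>The \<open>h\<close> equal roots multiply to the absolute value of
    \<open>Y v\<close>, and index 0 contributes the sign once.\<close>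
  have X: "prod x (block k v) = Y v" for v
  proof -
    have "prod x (block k v) = (\<Prod>i<h. if i = 0 then sgn (Y v) else 1) * root h \<bar>Y v\<bar> ^ h"
      by (simp add: prod_block x_def prod.distrib flip: h_def)
    also have "\<dots> = sgn (Y v) * \<bar>Y v\<bar>"
      using h by (simp add: prod.delta)
    finally show ?thesis
      by (simp add: sgn_mult_abs)
  qed
  show ?thesis
  proof (rule that[of x])
    from nz obtain u where "u \<in> U" "y u \<noteq> 0"
      by blast
    hence "(u, 0) \<in> power_verts k G" "x (u, 0) \<noteq> 0"
      using U h by (auto simp: power_verts_def x_def Y_def h_def sgn_if)
    thus "\<exists>w\<in>power_verts k G. x w \<noteq> 0"
      by blast
  next
    fix v i assume i: "i < k div 2"
    define P where "P = prod x (block k v - {(v, i)})"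
    define S where "S = (\<Sum>u | v \<rightarrow>\<^bsub>G\<^esub> u. Y u)"
    have "d v * x (v, i) ^ (k - 1) + P * S = l * x (v, i) ^ (k - 1)"
    proof (cases "Y v = 0")
      case True
      hence x0: "x (v, j) = 0" for j
        using h by (simp add: x_def)
      \<comment> \<open>\<open>h \<ge> 2\<close> provides a second entry of the block; it is zero
        and remains in \<open>P\<close> when \<open>(v, i)\<close> is removed.\<close>
      obtain j where "j < h" "j \<noteq> i"
        using h by (metis One_nat_def Suc_1 Suc_le_lessD less_trans_Suc n_not_Suc_n not_less_zero
            zero_less_iff_neq_zero less_2_cases_iff)
      hence "P = 0"
        unfolding P_def by (intro prod_zero) (auto simp: h_def x0 intro!: bexI[of _ "(v, j)"])
      thus ?thesis
        using k by (simp add: x0)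
    next
      case False
      hence v: "v \<in> U" and Yv: "Y v = y v"
        by (auto simp: Y_def split: if_splits)
      define z where "z = x (v, i) ^ (k - 1)"
      have x_nz: "x (v, i) \<noteq> 0"
        using False h by (simp add: x_def sgn_if)
      \<comment> \<open>Squaring removes the sign, after which the power \<open>h\<close> undoes the
        root.\<close>
      have "x (v, i) ^ k = (x (v, i) ^ 2) ^ h"
        by (simp add: k2 power_mult)
      also have "x (v, i) ^ 2 = root h \<bar>Y v\<bar> ^ 2"
        using False by (simp add: x_def power_mult_distrib sgn_if)
      also have "\<dots> ^ h = (root h \<bar>Y v\<bar> ^ h) ^ 2"
        by (simp add: mult.commute flip: power_mult)
      also have "\<dots> = (Y v)\<^sup>2"
        using h by simp
      finally have "x (v, i) * z = (Y v)\<^sup>2"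
        using k by (simp add: z_def power_eq_if)
      moreover have "Y v = x (v, i) * P"
        unfolding X[symmetric] P_def using i by (intro prod.remove) auto
      moreover have "d v * Y v + S = l * Y v"
      proof -
        have "S = (\<Sum>u | u \<in> U \<and> v \<rightarrow>\<^bsub>G\<^esub> u. y u)"
          unfolding S_def by (intro sum.mono_neutral_cong_right) (auto simp: Y_def)
        thus ?thesis
          using eig[OF v] by (simp add: sum_diagonal_plus_adjacency[OF U v] Yv)
      qed
      \<comment> \<open>Multiplied by \<open>x (v, i)\<close>, the claim becomes \<open>Y v\<close>
        times the matrix equation at \<open>v\<close>; the nonzero factor is cancelled
        afterwards.\<close>
      ultimately have "x (v, i) * (d v * z + P * S) = x (v, i) * (l * z)"
        by algebra
      thus ?thesis
        using x_nz by (simp add: z_def)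
    qed
    thus "d v * x (v, i) ^ (k - 1)
        + prod x (block k v - {(v, i)}) * (\<Sum>u | v \<rightarrow>\<^bsub>G\<^esub> u. prod x (block k u))
      = l * x (v, i) ^ (k - 1)"
      by (simp add: X P_def S_def)
  qed
qed

section \<open>Equality of the spectra\<close>

text \<open>The two tensors are treated together. \<open>M\<close> takes the vertex set as an
  argument because the adjacency matrix of \<open>G \<restriction> U\<close> changes with
  \<open>U\<close>, whereas \<open>Q(G)[U]\<close> restricts one fixed matrix.\<close>

lemma H_eigenvalues_power:
  fixes d :: "'a \<Rightarrow> real"
  assumes k: "even k" "k \<ge> 4"
    and T: "\<And>v i js. v \<in> verts G \<Longrightarrow> i < k div 2 \<Longrightarrow> T ((v, i) # js) =
      (if (v, i) # js = replicate k (v, i) then d v else 0)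
        + adjacency_tensor k (power_edges k G) ((v, i) # js)"
    and M: "\<And>U u v. U \<subseteq> verts G \<Longrightarrow> u \<in> U \<Longrightarrow> v \<in> U \<Longrightarrow>
      M U u v = (if u = v then d u else 0) + adjacency_matrix G u v"
  shows "H_eigenvalues k (power_verts k G) T =
    (\<Union>U \<in> {U. U \<subseteq> verts G \<and> U \<noteq> {} \<and> Digraph_Component.connected (G \<restriction> U)}. eigenvalues U (M U))"
    (is "_ = (\<Union>U \<in> ?\<U>. _)")
proof -
  have k0: "k > 0"
    using k by simp
  have verts: "w \<in> power_verts k G \<longleftrightarrow> fst w \<in> verts G \<and> snd w < k div 2" for w
    by (cases w) (auto simp: power_verts_def)
  have sum_T: "(\<Sum>js | set js \<subseteq> power_verts k G \<and> length js = k - 1. T ((v, i) # js) * prod_list (map x js))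
     = d v * x (v, i) ^ (k - 1)
         + prod x (block k v - {(v, i)}) * (\<Sum>u | v \<rightarrow>\<^bsub>G\<^esub> u. prod x (block k u))"
    if "v \<in> verts G" "i < k div 2" for v i x
    unfolding T[OF that] using that by (rule sum_power_tensor[OF k(1) k0])
  have M_eig: "eigenvalues U (M U) = complex_of_real ` {l. \<exists>y. (\<exists>u\<in>U. y u \<noteq> 0) \<and>
      (\<forall>v\<in>U. (\<Sum>u\<in>U. ((if v = u then d v else 0) + adjacency_matrix G v u) * y u) = l * y v)}"
    if U: "U \<subseteq> verts G" for U
  proof -
    \<comment> \<open>Edges are undirected, so \<open>M U\<close> is symmetric on \<open>U\<close>
      and its eigenvectors may be taken real.\<close>
    have "M U u v = M U v u" if "u \<in> U" "v \<in> U" for u v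
      using M[OF U] that by (auto simp: adjacency_matrix_def dest: dominates_sym)
    moreover have "finite U"
      using U finite_verts by (rule finite_subset)
    ultimately show ?thesis
      using M[OF U] by (simp add: eigenvalues_symmetric cong: sum.cong ball_cong)
  qed
  show ?thesis
  proof (intro equalityI subsetI)
    fix \<mu> assume "\<mu> \<in> H_eigenvalues k (power_verts k G) T"
    then obtain l x where \<mu>: "\<mu> = complex_of_real l" and nz: "\<exists>w\<in>power_verts k G. x w \<noteq> 0"
      and eig: "\<And>w. w \<in> power_verts k G \<Longrightarrow>
        (\<Sum>js | set js \<subseteq> power_verts k G \<and> length js = k - 1. T (w # js) * prod_list (map x js))
        = l * x w ^ (k - 1)"
      unfolding H_eigenvalues_real by blast
    from nz obtain v0 i0 where nz: "v0 \<in> verts G" "i0 < k div 2" "x (v0, i0) \<noteq> 0"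
      by (auto simp: verts)
    have "d v * x (v, i) ^ (k - 1)
        + prod x (block k v - {(v, i)}) * (\<Sum>u | v \<rightarrow>\<^bsub>G\<^esub> u. prod x (block k u))
      = l * x (v, i) ^ (k - 1)" if "v \<in> verts G" "i < k div 2" for v i
      using eig[of "(v, i)"] sum_T[OF that] that by (simp add: verts)
    with k(1) k0 nz obtain U y where U: "U \<subseteq> verts G" "U \<noteq> {}"
      "Digraph_Component.connected (G \<restriction> U)" and y: "\<exists>u\<in>U. y u \<noteq> 0"
      "\<forall>v\<in>U. (\<Sum>u\<in>U. ((if v = u then d v else 0) + adjacency_matrix G v u) * y u) = l * y v"
      by (rule connected_eigenvector_of_power)
    have "\<mu> \<in> eigenvalues U (M U)"
      unfolding M_eig[OF U(1)] \<mu> by (intro imageI CollectI exI[of _ y] conjI y)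
    with U show "\<mu> \<in> (\<Union>U \<in> ?\<U>. eigenvalues U (M U))"
      by blast
  next
    fix \<mu> assume "\<mu> \<in> (\<Union>U \<in> ?\<U>. eigenvalues U (M U))"
    then obtain U where U: "U \<subseteq> verts G" and "\<mu> \<in> eigenvalues U (M U)"
      by blast
    then obtain l y where \<mu>: "\<mu> = complex_of_real l"
      and nz: "\<exists>u\<in>U. y u \<noteq> 0" and eig: "\<And>v. v \<in> U \<Longrightarrow>
        (\<Sum>u\<in>U. ((if v = u then d v else 0) + adjacency_matrix G v u) * y u) = l * y v"
      unfolding M_eig[OF U] by blast
    obtain x where x: "\<exists>w\<in>power_verts k G. x w \<noteq> 0"
      "\<And>v i. i < k div 2 \<Longrightarrow>
        d v * x (v, i) ^ (k - 1)
          + prod x (block k v - {(v, i)}) * (\<Sum>u | v \<rightarrow>\<^bsub>G\<^esub> u. prod x (block k u))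
        = l * x (v, i) ^ (k - 1)"
      using power_eigenvector_of_subset[OF k U nz eig] by blast
    have "(\<Sum>js | set js \<subseteq> power_verts k G \<and> length js = k - 1. T (w # js) * prod_list (map x js))
        = l * x w ^ (k - 1)" if "w \<in> power_verts k G" for w
      using that sum_T x(2) by (cases w) (simp add: verts)
    with x(1) show "\<mu> \<in> H_eigenvalues k (power_verts k G) T"
      unfolding H_eigenvalues_real \<mu> by blast
  qed
qed

end

theorem theorem3p5:
  fixes G :: "('a, 'b) pre_digraph" and k :: nat
  assumes "graph G" and "even k" and "k \<ge> 4"
  shows "H_eigenvalues k (power_verts k G) (adjacency_tensor k (power_edges k G)) =
      (\<Union>U \<in> {U. U \<subseteq> verts G \<and> U \<noteq> {} \<and> Digraph_Component.connected (G \<restriction> U)}.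
         eigenvalues U (adjacency_matrix (G \<restriction> U)))
    \<and> H_eigenvalues k (power_verts k G) (signless_laplacian_tensor k (power_edges k G)) =
      (\<Union>U \<in> {U. U \<subseteq> verts G \<and> U \<noteq> {} \<and> Digraph_Component.connected (G \<restriction> U)}.
         eigenvalues U (signless_laplacian_matrix G))"
proof -
  interpret graph G by fact
  show ?thesis
  proof (intro conjI)
    show "H_eigenvalues k (power_verts k G) (adjacency_tensor k (power_edges k G)) =
      (\<Union>U \<in> {U. U \<subseteq> verts G \<and> U \<noteq> {} \<and> Digraph_Component.connected (G \<restriction> U)}.
         eigenvalues U (adjacency_matrix (G \<restriction> U)))"
      \<comment> \<open>Between vertices of \<open>U\<close> the arcs of
        \<open>G \<restriction> U\<close> are those of \<open>G\<close>, so the matrix has the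
        required form with zero diagonal.\<close>
      by (rule H_eigenvalues_power[where d = "\<lambda>_. 0"])
         (use assms in \<open>auto simp: adjacency_matrix_def induce_subgraph_dominates_iff\<close>)
    show "H_eigenvalues k (power_verts k G) (signless_laplacian_tensor k (power_edges k G)) =
      (\<Union>U \<in> {U. U \<subseteq> verts G \<and> U \<noteq> {} \<and> Digraph_Component.connected (G \<restriction> U)}.
         eigenvalues U (signless_laplacian_matrix G))"
      \<comment> \<open>Degrees are taken in all of \<open>G\<close>, as the loops of the modified
        induced subgraph require; they are also the hypergraph degrees of the copies
        \<open>(v, i)\<close>.\<close>
      by (rule H_eigenvalues_power[where d = "\<lambda>v. real (degree (edges G) v)"])
         (use assms in \<open>auto simp: signless_laplacian_tensor_def degree_tensor_def
            signless_laplacian_matrix_def degree_matrix_def degree_power_edges\<close>)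
  qed
qed

end
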